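(* Fix real numbers $c<d$. The spaces $\mathrm{(ffid^{[c,d]})}$ and $\mathrm{(ffid)}$, and the path component of the zero module in each of $\mathrm{(cfid)}$, $\mathrm{(pfd)}$ and $\mathrm{(rid)}$, with the topology induced by the interleaving distance, are contractible to the zero module (i.e. on each of these spaces the identity map is homotopic to the constant map to the zero module).
   Context: Fix a field $\mathbf{k}$. A persistence module is a functor $M:(\mathbb{R},\le)\to \mathrm{Vect}_{\mathbf{k}}$; "persistence module" means isomorphism class. For an interval $J\subset\mathbb{R}$, the interval module $J$ is $\mathbf{k}$ at points of $J$ and $0$ elsewhere, with identity maps between points of $J$ and zero maps otherwise. For $\varepsilon\ge 0$, $M,N$ are $\varepsilon$-interleaved if there are families of linear maps $\varphi_a:M(a)\to N(a+\varepsilon)$ and $\psi_a:N(a)\to M(a+\varepsilon)$, natural in $a\in\mathbb{R}$, with $\psi_{a+\varepsilon}\varphi_a=M(a\le a+2\varepsilon)$ and $\varphi_{a+\varepsilon}\psi_a=N(a\le a+2\varepsilon)$ for all $a$. The interleaving distance is $d_I(M,N)=\inf\{\varepsilon\ge0 : M,N \text{ are } \varepsilon\text{-interleaved}\}$ ($\infty$ if there is none). It is an extended pseudometric; the induced topology has the open balls $B_r(M)=\{N: d_I(M,N)<r\}$, $r>0$, as a base. $\mathrm{(ffid)}$: finite direct sums of interval modules with all intervals finite (bounded), including the zero module; $\mathrm{(ffid^{[c,d]})}$: those in $\mathrm{(ffid)}$ with all intervals contained in $[c,d]$; $\mathrm{(cfid)}$: direct sums of countably many interval modules with all intervals finite (bounded);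 $\mathrm{(pfd)}$: persistence modules $M$ with every $M(a)$ finite dimensional; $\mathrm{(rid)}$: direct sums $\bigoplus_{\alpha\in A}I_\alpha$ of interval modules with $|A|\le|\mathbb{R}|$. *)

theory Defs
  imports "HOL-Analysis.Analysis" "HOL-Library.Function_Algebras"
begin

text \<open>
  All vector spaces \<open>M(a)\<close> of one persistence module are subspaces of one ambient vector space of
  type \<open>'v\<close>, with scalar multiplication \<open>s\<close>. The transition map \<open>pmap M a b\<close> is relevant only for
  \<open>a \<le> b\<close> and on \<open>pspace M a\<close>.
\<close>

record 'v pers =
  pspace :: "real \<Rightarrow> 'v set"
  pmap :: "real \<Rightarrow> real \<Rightarrow> 'v \<Rightarrow> 'v"

definition linear_map_on ::
  "('k::field \<Rightarrow> 'v::ab_group_add \<Rightarrow> 'v) \<Rightarrow> 'v set \<Rightarrow> 'v set \<Rightarrow> ('v \<Rightarrow> 'v) \<Rightarrow> bool" where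
  "linear_map_on s V W f \<longleftrightarrow>
     f \<in> V \<rightarrow> W \<and>
     (\<forall>x\<in>V. \<forall>y\<in>V. f (x + y) = f x + f y) \<and>
     (\<forall>c. \<forall>x\<in>V. f (s c x) = s c (f x))"

definition pers_module ::
  "('k::field \<Rightarrow> 'v::ab_group_add \<Rightarrow> 'v) \<Rightarrow> 'v pers \<Rightarrow> bool" where
  "pers_module s M \<longleftrightarrow>
     (\<forall>a. module.subspace s (pspace M a)) \<and>
     (\<forall>a b. a \<le> b \<longrightarrow> linear_map_on s (pspace M a) (pspace M b) (pmap M a b)) \<and>
     (\<forall>a. \<forall>x\<in>pspace M a. pmap M a a x = x) \<and>
     (\<forall>a b c. a \<le> b \<longrightarrow> b \<le> c \<longrightarrow>
        (\<forall>x\<in>pspace M a. pmap M b c (pmap M a b x) = pmap M a c x))"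

definition shift_hom ::
  "('k::field \<Rightarrow> 'v::ab_group_add \<Rightarrow> 'v) \<Rightarrow> real \<Rightarrow> 'v pers \<Rightarrow> 'v pers \<Rightarrow>
   (real \<Rightarrow> 'v \<Rightarrow> 'v) \<Rightarrow> bool" where
  "shift_hom s e M N \<phi> \<longleftrightarrow>
     (\<forall>a. linear_map_on s (pspace M a) (pspace N (a + e)) (\<phi> a)) \<and>
     (\<forall>a b. a \<le> b \<longrightarrow>
        (\<forall>x\<in>pspace M a. \<phi> b (pmap M a b x) = pmap N (a + e) (b + e) (\<phi> a x)))"

definition pers_iso ::
  "('k::field \<Rightarrow> 'v::ab_group_add \<Rightarrow> 'v) \<Rightarrow> 'v pers \<Rightarrow> 'v pers \<Rightarrow> bool" where
  "pers_iso s M N \<longleftrightarrow>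
     (\<exists>\<phi>. shift_hom s 0 M N \<phi> \<and> (\<forall>a. bij_betw (\<phi> a) (pspace M a) (pspace N a)))"

definition interleaved ::
  "('k::field \<Rightarrow> 'v::ab_group_add \<Rightarrow> 'v) \<Rightarrow> real \<Rightarrow> 'v pers \<Rightarrow> 'v pers \<Rightarrow> bool" where
  "interleaved s e M N \<longleftrightarrow>
     (\<exists>\<phi> \<psi>. shift_hom s e M N \<phi> \<and> shift_hom s e N M \<psi> \<and>
        (\<forall>a. \<forall>x\<in>pspace M a. \<psi> (a + e) (\<phi> a x) = pmap M a (a + 2 * e) x) \<and>
        (\<forall>a. \<forall>x\<in>pspace N a. \<phi> (a + e) (\<psi> a x) = pmap N a (a + 2 * e) x))"

definition interval_module :: "real set \<Rightarrow> 'k::field pers" where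
  "interval_module J =
     \<lparr> pspace = (\<lambda>a. if a \<in> J then UNIV else {0}),
       pmap = (\<lambda>a b x. if a \<in> J \<and> b \<in> J then x else 0) \<rparr>"

definition pointwise_scale :: "('k \<Rightarrow> 'v \<Rightarrow> 'v) \<Rightarrow> 'k \<Rightarrow> ('i \<Rightarrow> 'v) \<Rightarrow> 'i \<Rightarrow> 'v" where
  "pointwise_scale s c f = (\<lambda>i. s c (f i))"

definition direct_sum :: "'i set \<Rightarrow> ('i \<Rightarrow> 'v::ab_group_add pers) \<Rightarrow> ('i \<Rightarrow> 'v) pers" where
  "direct_sum A M =
     \<lparr> pspace = (\<lambda>a. {f. (\<forall>i\<in>A. f i \<in> pspace (M i) a) \<and> (\<forall>i. i \<notin> A \<longrightarrow> f i = 0) \<and>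
                         finite {i. f i \<noteq> 0}}),
       pmap = (\<lambda>a b f i. if i \<in> A then pmap (M i) a b (f i) else 0) \<rparr>"

text \<open>
  The ambient space for the spaces of persistence modules is \<open>real \<Rightarrow> 'k\<close>. Its dimension is at least
  the cardinality of the reals, so it contains a copy of every vector space that occurs in a
  pointwise finite-dimensional module or in a direct sum of at most \<open>|\<real>|\<close> interval modules.
  An index set of cardinality at most \<open>|\<real>|\<close> is, up to bijection, a set of reals. An isomorphism class
  is the set of all modules in the ambient space that are isomorphic to a given one.
\<close>

type_synonym 'k rpers = "(real \<Rightarrow> 'k) pers"

abbreviation rscale :: "'k::field \<Rightarrow> (real \<Rightarrow> 'k) \<Rightarrow> (real \<Rightarrow> 'k)" where
  "rscale \<equiv> pointwise_scale (*)"

definition iso_class :: "'k::field rpers \<Rightarrow> 'k rpers set" where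
  "iso_class M = {N. pers_module rscale N \<and> pers_iso rscale M N}"

definition zero_module :: "'k::field rpers" where
  "zero_module = \<lparr> pspace = (\<lambda>_. {0}), pmap = (\<lambda>_ _ _. 0) \<rparr>"

definition zero_iso_class :: "'k::field rpers set" where
  "zero_iso_class = iso_class zero_module"

definition interval_sum :: "real set \<Rightarrow> (real \<Rightarrow> real set) \<Rightarrow> 'k::field rpers" where
  "interval_sum A I = direct_sum A (\<lambda>i. interval_module (I i))"

definition interval_family :: "real set \<Rightarrow> (real \<Rightarrow> real set) \<Rightarrow> bool" where
  "interval_family A I \<longleftrightarrow> (\<forall>i\<in>A. is_interval (I i) \<and> I i \<noteq> {})"

definition ffid_in :: "real \<Rightarrow> real \<Rightarrow> 'k::field rpers set set" where
  "ffid_in c d = {iso_class (interval_sum A I) | A I.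
     interval_family A I \<and> finite A \<and> (\<forall>i\<in>A. I i \<subseteq> {c..d})}"

definition ffid :: "'k::field rpers set set" where
  "ffid = {iso_class (interval_sum A I) | A I.
     interval_family A I \<and> finite A \<and> (\<forall>i\<in>A. bounded (I i))}"

definition cfid :: "'k::field rpers set set" where
  "cfid = {iso_class (interval_sum A I) | A I.
     interval_family A I \<and> countable A \<and> (\<forall>i\<in>A. bounded (I i))}"

definition rid :: "'k::field rpers set set" where
  "rid = {iso_class (interval_sum A I) | A I. interval_family A I}"

definition pfd :: "'k::field rpers set set" where
  "pfd = {iso_class M | M. pers_module rscale M \<and>
     (\<forall>a. \<exists>B. finite B \<and> \<not> module.dependent rscale B \<and> module.span rscale B = pspace M a)}"

definition interleaving_dist :: "'k::field rpers set \<Rightarrow> 'k rpers set \<Rightarrow> ennreal" where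
  "interleaving_dist X Y =
     Inf {ennreal e | e M N. 0 \<le> e \<and> M \<in> X \<and> N \<in> Y \<and> interleaved rscale e M N}"

text \<open>
  As for \<^const>\<open>Metric_space.mtopology\<close>; by the triangle inequality the open balls form a base.
  Restricting the balls to \<open>S\<close> gives the subspace topology on \<open>S\<close>.
\<close>

definition interleaving_topology :: "'k::field rpers set set \<Rightarrow> 'k rpers set topology" where
  "interleaving_topology S = topology (\<lambda>U. U \<subseteq> S \<and>
     (\<forall>X\<in>U. \<exists>r>0. {Y\<in>S. interleaving_dist X Y < ennreal r} \<subseteq> U))"

definition path_component_space :: "'a topology \<Rightarrow> 'a \<Rightarrow> 'a topology" where
  "path_component_space T x = subtopology T (path_component_of_set T x)"

definition contractible_to :: "'a topology \<Rightarrow> 'a \<Rightarrow> bool" where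
  "contractible_to T p \<longleftrightarrow>
     p \<in> topspace T \<and> homotopic_with (\<lambda>_. True) T T id (\<lambda>_. p)"


lemma vector_space_rscale: "vector_space (rscale :: 'k::field \<Rightarrow> _)"
  by unfold_locales (auto simp: pointwise_scale_def fun_eq_iff algebra_simps)

lemma openin_interleaving_topology:
  "openin (interleaving_topology S) U \<longleftrightarrow> U \<subseteq> S \<and>
     (\<forall>X\<in>U. \<exists>r>0. {Y\<in>S. interleaving_dist X Y < ennreal r} \<subseteq> U)"
proof -
  define P where "P U \<longleftrightarrow> U \<subseteq> S \<and>
      (\<forall>X\<in>U. \<exists>r>0. {Y\<in>S. interleaving_dist X Y < ennreal r} \<subseteq> U)" for U
  have "P (U \<inter> V)" if U: "P U" and V: "P V" for U V
    unfolding P_def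
  proof (intro conjI ballI)
    show "U \<inter> V \<subseteq> S" using U unfolding P_def by blast
    fix X assume X: "X \<in> U \<inter> V"
    obtain r where r: "r > 0" "{Y\<in>S. interleaving_dist X Y < ennreal r} \<subseteq> U"
      using U X unfolding P_def by blast
    obtain q where q: "q > 0" "{Y\<in>S. interleaving_dist X Y < ennreal q} \<subseteq> V"
      using V X unfolding P_def by blast
    have le: "ennreal (min r q) \<le> ennreal r" "ennreal (min r q) \<le> ennreal q"
      by (auto intro: ennreal_leI)
    have "{Y\<in>S. interleaving_dist X Y < ennreal (min r q)} \<subseteq> U \<inter> V"
      using r(2) q(2) order.strict_trans2[OF _ le(1)] order.strict_trans2[OF _ le(2)] by blast
    moreover have "0 < min r q" using r(1) q(1) by simp
    ultimately show "\<exists>r>0. {Y\<in>S. interleaving_dist X Y < ennreal r} \<subseteq> U \<inter> V"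
      by blast
  qed
  moreover have "P (\<Union>\<K>)" if K: "\<forall>K\<in>\<K>. P K" for \<K>
    unfolding P_def
  proof (intro conjI ballI)
    show "\<Union>\<K> \<subseteq> S" using K unfolding P_def by blast
    fix X assume "X \<in> \<Union>\<K>"
    then obtain K where "K \<in> \<K>" "X \<in> K" by blast
    moreover from this K obtain r
      where "r > 0" "{Y\<in>S. interleaving_dist X Y < ennreal r} \<subseteq> K" unfolding P_def by blast
    ultimately show "\<exists>r>0. {Y\<in>S. interleaving_dist X Y < ennreal r} \<subseteq> \<Union>\<K>"
      by (meson Union_upper subset_trans)
  qed
  ultimately have "istopology P"
    unfolding istopology_def by simp
  then show ?thesis
    unfolding interleaving_topology_def P_def by (simp add: topology_inverse')
qed

lemma topspace_interleaving_topology [simp]: "topspace (interleaving_topology S) = S"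
proof -
  have "openin (interleaving_topology S) S"
    unfolding openin_interleaving_topology by (auto intro: exI[of _ 1])
  moreover have "topspace (interleaving_topology S) \<subseteq> S"
    using openin_topspace[of "interleaving_topology S"]
    unfolding openin_interleaving_topology by (rule conjunct1)
  ultimately show ?thesis
    using openin_subset by blast
qed

lemma pspace_interval_sum:
  "f \<in> pspace (interval_sum A I) a \<longleftrightarrow>
     finite {i. f i \<noteq> 0} \<and> (\<forall>i. f i \<noteq> 0 \<longrightarrow> i \<in> A \<and> a \<in> I i)"
  unfolding interval_sum_def direct_sum_def interval_module_def pers.simps mem_Collect_eq
  by (metis UNIV_I singleton_iff)

lemma pmap_interval_sum:
  "pmap (interval_sum A I) a b f i = (if i \<in> A \<and> a \<in> I i \<and> b \<in> I i then f i else 0)"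
  by (simp add: interval_sum_def direct_sum_def interval_module_def)

lemma pers_module_interval_sum:
  assumes "interval_family A I"
  shows "pers_module rscale (interval_sum A I :: 'k::field rpers)"
proof -
  interpret vector_space "rscale :: 'k \<Rightarrow> _" by (rule vector_space_rscale)
  let ?M = "interval_sum A I :: 'k rpers"
  have conv: "b \<in> I i" if "i \<in> A" "a \<le> b" "b \<le> c" "a \<in> I i" "c \<in> I i" for i a b c
    using assms that unfolding interval_family_def is_interval_1 by blast
  have "subspace (pspace ?M a)" for a
  proof (rule subspaceI)
    show "0 \<in> pspace ?M a" by (simp add: pspace_interval_sum)
  next
    fix f g :: "real \<Rightarrow> 'k"
    assume f: "f \<in> pspace ?M a" and g: "g \<in> pspace ?M a"
    have sub: "{i. (f + g) i \<noteq> 0} \<subseteq> {i. f i \<noteq> 0} \<union> {i. g i \<noteq> 0}" by auto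
    show "f + g \<in> pspace ?M a"
      using finite_subset[OF sub] sub f g unfolding pspace_interval_sum by blast
  next
    fix c and f :: "real \<Rightarrow> 'k"
    assume f: "f \<in> pspace ?M a"
    have sub: "{i. rscale c f i \<noteq> 0} \<subseteq> {i. f i \<noteq> 0}" by (auto simp: pointwise_scale_def)
    show "rscale c f \<in> pspace ?M a"
      using finite_subset[OF sub] sub f unfolding pspace_interval_sum by blast
  qed
  moreover have "linear_map_on rscale (pspace ?M a) (pspace ?M b) (pmap ?M a b)" for a b
  proof -
    have "pmap ?M a b f \<in> pspace ?M b" if f: "f \<in> pspace ?M a" for f
    proof -
      have sub: "{i. pmap ?M a b f i \<noteq> 0} \<subseteq> {i. f i \<noteq> 0}"
        by (auto simp: pmap_interval_sum)
      have "i \<in> A \<and> b \<in> I i" if "pmap ?M a b f i \<noteq> 0" for i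
        using that by (metis pmap_interval_sum)
      then show ?thesis
        using finite_subset[OF sub] f unfolding pspace_interval_sum by blast
    qed
    then show ?thesis
      unfolding linear_map_on_def
      by (simp add: Pi_iff fun_eq_iff pmap_interval_sum pointwise_scale_def)
  qed
  moreover have "pmap ?M a a f = f" if f: "f \<in> pspace ?M a" for a f
  proof
    fix i
    show "pmap ?M a a f i = f i"
      using f unfolding pspace_interval_sum pmap_interval_sum by metis
  qed
  moreover have "pmap ?M b c (pmap ?M a b f) = pmap ?M a c f" if "a \<le> b" "b \<le> c" for a b c f
  proof
    fix i
    show "pmap ?M b c (pmap ?M a b f) i = pmap ?M a c f i"
      using conv[OF _ that, of i] unfolding pmap_interval_sum by auto
  qed
  ultimately show ?thesis
    unfolding pers_module_def by simp
qed

lemma interval_sum_empty: "interval_sum {} I = zero_module"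
proof -
  have "{f :: real \<Rightarrow> 'a. \<forall>i. f i = 0} = {0}" by (auto simp: fun_eq_iff)
  then show ?thesis
    by (simp add: interval_sum_def direct_sum_def zero_module_def zero_fun_def cong: conj_cong)
qed

lemma zero_iso_class_mem:
  "(zero_iso_class :: 'k::field rpers set) \<in> ffid_in c d \<inter> ffid \<inter> cfid \<inter> pfd \<inter> rid"
proof -
  interpret vector_space "rscale :: 'k \<Rightarrow> _" by (rule vector_space_rscale)
  have I: "interval_family {} I" for I by (simp add: interval_family_def)
  have Z: "zero_iso_class = iso_class (interval_sum {} I)" for I
    by (simp add: zero_iso_class_def interval_sum_empty)
  have 1: "pers_module rscale (zero_module :: 'k rpers)"
    using pers_module_interval_sum[OF I] by (simp add: interval_sum_empty)
  have 2: "\<exists>B. finite B \<and> \<not> dependent B \<and> span B = pspace zero_module a" for a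
    by (rule exI[of _ "{}"]) (simp add: zero_module_def independent_empty)
  have "zero_iso_class \<in> (pfd :: 'k rpers set set)"
    unfolding pfd_def zero_iso_class_def mem_Collect_eq
    by (rule exI[of _ zero_module]) (simp only: 1 2 simp_thms)
  moreover have "zero_iso_class \<in> (ffid_in c d :: 'k rpers set set)"
    unfolding ffid_in_def mem_Collect_eq
    by (rule exI[of _ "{}"], rule exI[of _ "\<lambda>_. {}"]) (simp add: I flip: Z)
  moreover have "zero_iso_class \<in> (ffid :: 'k rpers set set)"
    unfolding ffid_def mem_Collect_eq
    by (rule exI[of _ "{}"], rule exI[of _ "\<lambda>_. {}"]) (simp add: I flip: Z)
  moreover have "zero_iso_class \<in> (cfid :: 'k rpers set set)"
    unfolding cfid_def mem_Collect_eq
    by (rule exI[of _ "{}"], rule exI[of _ "\<lambda>_. {}"]) (simp add: I flip: Z)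
  moreover have "zero_iso_class \<in> (rid :: 'k rpers set set)"
    unfolding rid_def mem_Collect_eq
    by (rule exI[of _ "{}"], rule exI[of _ "\<lambda>_. {}"]) (simp add: I flip: Z)
  ultimately show ?thesis by simp
qed

end

theory Submission imports Defs begin

text \<open>
  One homotopy contracts all five spaces. For \<open>r \<ge> 0\<close> let \<open>M\<^sup>r\<close> be the persistence module with
  \<open>M\<^sup>r(a) = im (M(a - r) \<rightarrow> M(a + r))\<close>; on an interval module it cuts off length \<open>r\<close> at each end.
  Since the construction is functorial and commutes with shifts, an \<open>e\<close>-interleaving of \<open>M\<close> and \<open>N\<close>
  induces one of \<open>M\<^sup>r\<close> and \<open>N\<^sup>r\<close>. The transition maps of \<open>M\<close> and the inclusions of images interleave
  \<open>M\<^sup>r\<close> and \<open>M\<^sup>q\<close> with parameter \<open>\<bar>r - q\<bar>\<close>. So \<open>(r, M) \<mapsto> M\<^sup>r\<close> is Lipschitz in both variables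
  (\<open>interleaved_shrink_shrink\<close>).

  A module is \<open>e\<close>-interleaved with zero iff all its transition maps of length \<open>2 e\<close> vanish
  (\<open>interleaved_zero_iff\<close>), and then \<open>M\<^sup>r = 0\<close> for all \<open>r \<ge> e\<close>. Hence \<open>t \<mapsto> M\<^sup>r\<close> with
  \<open>r = t / (1 - t)\<close> runs from \<open>M\<close> to the zero module if the distance of \<open>M\<close> to zero is finite. This is
  jointly continuous in \<open>t\<close> and \<open>M\<close> also at \<open>t = 1\<close>, because \<open>N\<^sup>r = 0\<close> for all
  \<open>r > e + 1\<close> and all \<open>N\<close> at distance less than \<open>1\<close> from \<open>M\<close> (\<open>continuous_contraction\<close>).

  All five classes are closed under \<open>M \<mapsto> M\<^sup>r\<close>: interval sums because the summands shrink inside the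
  given intervals, pointwise finite-dimensional modules because \<open>M\<^sup>r(a)\<close> is a subspace of
  \<open>M(a + r)\<close>. Finite sums of bounded intervals are at finite distance from zero. In the other
  classes, the modules at finite distance form a set that is open and closed, hence contains the path
  component of zero; the contraction itself joins each of its points to zero, so the two sets agree
  (\<open>path_component_zero\<close>).
\<close>

section \<open>Interleavings\<close>

lemma pers_moduleD:
  assumes "pers_module s M"
  shows "module.subspace s (pspace M a)"
    and "a \<le> b \<Longrightarrow> linear_map_on s (pspace M a) (pspace M b) (pmap M a b)"
    and "x \<in> pspace M a \<Longrightarrow> pmap M a a x = x"
    and "a \<le> b \<Longrightarrow> b \<le> c \<Longrightarrow> x \<in> pspace M a \<Longrightarrow> pmap M b c (pmap M a b x) = pmap M a c x"
  using assms unfolding pers_module_def by blast+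

lemma linear_map_onD:
  assumes "linear_map_on s V W f"
  shows "x \<in> V \<Longrightarrow> f x \<in> W"
    and "x \<in> V \<Longrightarrow> y \<in> V \<Longrightarrow> f (x + y) = f x + f y"
    and "x \<in> V \<Longrightarrow> f (s c x) = s c (f x)"
  using assms unfolding linear_map_on_def by auto

lemma pmap_in:
  "pers_module s M \<Longrightarrow> a \<le> b \<Longrightarrow> x \<in> pspace M a \<Longrightarrow> pmap M a b x \<in> pspace M b"
  using linear_map_onD(1) pers_moduleD(2) by metis

lemma linear_map_on_compose:
  assumes "linear_map_on s U V f" and "linear_map_on s V W g"
  shows "linear_map_on s U W (\<lambda>x. g (f x))"
  using assms by (auto simp: linear_map_on_def Pi_iff)

lemma linear_map_on_restrict:
  assumes "linear_map_on s V W f" and "V' \<subseteq> V" and "f ` V' \<subseteq> W'"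
  shows "linear_map_on s V' W' f"
  using assms unfolding linear_map_on_def Pi_iff by blast

lemma linear_map_on_zero:
  assumes "vector_space s" and "linear_map_on s V W f" and "0 \<in> V"
  shows "f 0 = 0"
proof -
  interpret vector_space s by fact
  show ?thesis
    using linear_map_onD(3)[OF assms(2,3), of 0] by simp
qed

lemma linear_map_on_image_subspace:
  assumes "vector_space s" and f: "linear_map_on s V W f" and "module.subspace s V"
  shows "module.subspace s (f ` V)"
proof -
  interpret vector_space s by fact
  note V = \<open>subspace V\<close>
  show ?thesis
  proof (rule subspaceI)
    show "0 \<in> f ` V"
      using linear_map_on_zero[OF assms(1) f] subspace_0[OF V] by force
  next
    fix x y assume "x \<in> f ` V" "y \<in> f ` V"
    then obtain u v where "u \<in> V" "v \<in> V" "x = f u" "y = f v" by blast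
    then have "x + y = f (u + v)" "u + v \<in> V"
      using linear_map_onD(2)[OF f] subspace_add[OF V] by simp_all
    then show "x + y \<in> f ` V" by blast
  next
    fix c x assume "x \<in> f ` V"
    then obtain u where "u \<in> V" "x = f u" by blast
    then have "s c x = f (s c u)" "s c u \<in> V"
      using linear_map_onD(3)[OF f] subspace_scale[OF V] by simp_all
    then show "s c x \<in> f ` V" by blast
  qed
qed

lemma shift_homD:
  assumes "shift_hom s e M N \<phi>"
  shows "linear_map_on s (pspace M a) (pspace N (a + e)) (\<phi> a)"
    and "x \<in> pspace M a \<Longrightarrow> \<phi> a x \<in> pspace N (a + e)"
    and "a \<le> b \<Longrightarrow> x \<in> pspace M a \<Longrightarrow> \<phi> b (pmap M a b x) = pmap N (a + e) (b + e) (\<phi> a x)"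
  using assms unfolding shift_hom_def linear_map_on_def by blast+

lemma shift_hom_compose:
  assumes f: "shift_hom s d M N \<phi>" and g: "shift_hom s e N P \<psi>"
  shows "shift_hom s (d + e) M P (\<lambda>a x. \<psi> (a + d) (\<phi> a x))"
  unfolding shift_hom_def
proof (intro conjI allI impI ballI)
  fix a
  show "linear_map_on s (pspace M a) (pspace P (a + (d + e))) (\<lambda>x. \<psi> (a + d) (\<phi> a x))"
    using linear_map_on_compose[OF shift_homD(1)[OF f] shift_homD(1)[OF g]]
    by (simp add: add.assoc)
  fix b x assume "a \<le> b" "x \<in> pspace M a"
  then show "\<psi> (b + d) (\<phi> b (pmap M a b x))
      = pmap P (a + (d + e)) (b + (d + e)) (\<psi> (a + d) (\<phi> a x))"
    using shift_homD(3)[OF f] shift_homD(2)[OF f] shift_homD(3)[OF g, of "a + d" "b + d"]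
    by (simp add: add.assoc)
qed

lemma interleaved_sym: "interleaved s e M N \<Longrightarrow> interleaved s e N M"
  unfolding interleaved_def by blast

text \<open>
  Half of the triangle inequality. Of the two composites that \<open>interleaved_trans\<close> needs, one is this
  statement and the other is its mirror image. The inner round trip \<open>\<psi>' \<phi>'\<close> is a transition map of
  \<open>N\<close>, which naturality of \<open>\<psi>\<close> moves to \<open>M\<close>, where it meets the outer round trip.
\<close>

lemma interleaved_round_trip:
  assumes M: "pers_module s M" and "0 \<le> d" "0 \<le> e"
    and f: "shift_hom s d M N \<phi>" and f': "shift_hom s d N M \<psi>"
    and g: "shift_hom s e N P \<phi>'"
    and ff: "\<And>a x. x \<in> pspace M a \<Longrightarrow> \<psi> (a + d) (\<phi> a x) = pmap M a (a + 2 * d) x"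
    and gg: "\<And>a x. x \<in> pspace N a \<Longrightarrow> \<psi>' (a + e) (\<phi>' a x) = pmap N a (a + 2 * e) x"
    and x: "x \<in> pspace M a"
  shows "\<psi> (a + (d + e) + e) (\<psi>' (a + (d + e)) (\<phi>' (a + d) (\<phi> a x)))
    = pmap M a (a + 2 * (d + e)) x"
proof -
  have 1: "\<psi>' (a + (d + e)) (\<phi>' (a + d) (\<phi> a x)) = pmap N (a + d) (a + d + 2 * e) (\<phi> a x)"
    using gg[OF shift_homD(2)[OF f x]] by (simp add: add.assoc)
  have 2: "a + (d + e) + e = a + d + 2 * e" by simp
  have "\<psi> (a + d + 2 * e) (pmap N (a + d) (a + d + 2 * e) (\<phi> a x))
      = pmap M (a + d + d) (a + d + 2 * e + d) (\<psi> (a + d) (\<phi> a x))"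
    using shift_homD(3)[OF f' _ shift_homD(2)[OF f x]] \<open>0 \<le> e\<close> by simp
  also have "\<dots> = pmap M (a + 2 * d) (a + 2 * (d + e)) (pmap M a (a + 2 * d) x)"
    by (simp add: ff[OF x] algebra_simps)
  also have "\<dots> = pmap M a (a + 2 * (d + e)) x"
    by (rule pers_moduleD(4)[OF M _ _ x]) (use \<open>0 \<le> d\<close> \<open>0 \<le> e\<close> in auto)
  finally show ?thesis unfolding 1 2 .
qed

lemma interleaved_trans:
  assumes M: "pers_module s M" and P: "pers_module s P" and d: "0 \<le> d" and e: "0 \<le> e"
    and "interleaved s d M N" and "interleaved s e N P"
  shows "interleaved s (d + e) M P"
proof -
  obtain \<phi> \<psi> where f: "shift_hom s d M N \<phi>" "shift_hom s d N M \<psi>"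
    "\<And>a x. x \<in> pspace M a \<Longrightarrow> \<psi> (a + d) (\<phi> a x) = pmap M a (a + 2 * d) x"
    "\<And>a x. x \<in> pspace N a \<Longrightarrow> \<phi> (a + d) (\<psi> a x) = pmap N a (a + 2 * d) x"
    using assms(5) unfolding interleaved_def by blast
  obtain \<phi>' \<psi>' where g: "shift_hom s e N P \<phi>'" "shift_hom s e P N \<psi>'"
    "\<And>a x. x \<in> pspace N a \<Longrightarrow> \<psi>' (a + e) (\<phi>' a x) = pmap N a (a + 2 * e) x"
    "\<And>a x. x \<in> pspace P a \<Longrightarrow> \<phi>' (a + e) (\<psi>' a x) = pmap P a (a + 2 * e) x"
    using assms(6) unfolding interleaved_def by blast
  show ?thesis
    unfolding interleaved_def
  proof (intro exI conjI allI ballI)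
    show "shift_hom s (d + e) M P (\<lambda>a x. \<phi>' (a + d) (\<phi> a x))"
      by (rule shift_hom_compose[OF f(1) g(1)])
    show "shift_hom s (d + e) P M (\<lambda>a x. \<psi> (a + e) (\<psi>' a x))"
      using shift_hom_compose[OF g(2) f(2)] by (simp add: add.commute)
    show "\<psi> (a + (d + e) + e) (\<psi>' (a + (d + e)) (\<phi>' (a + d) (\<phi> a x)))
        = pmap M a (a + 2 * (d + e)) x" if "x \<in> pspace M a" for a x
      by (rule interleaved_round_trip[OF M d e f(1,2) g(1) f(3) g(3) that])
    show "\<phi>' (a + (d + e) + d) (\<phi> (a + (d + e)) (\<psi> (a + e) (\<psi>' a x)))
        = pmap P a (a + 2 * (d + e)) x" if "x \<in> pspace P a" for a x
      using interleaved_round_trip[OF P e d g(2,1) f(2) g(4) f(4) that]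
      by (simp add: add.commute[of d e])
  qed
qed

text \<open>
  The two maps of a \<open>0\<close>-interleaving are mutually inverse, as the transition maps from \<open>a\<close> to \<open>a\<close> are
  identities. So all that is needed about isomorphisms (symmetry, transitivity, functoriality
  of shrinking) is an instance of a fact about interleavings.
\<close>

lemma pers_iso_iff_interleaved_0:
  assumes s: "vector_space s" and M: "pers_module s M" and N: "pers_module s N"
  shows "pers_iso s M N \<longleftrightarrow> interleaved s 0 M N"
proof
  interpret vector_space s by fact
  assume "pers_iso s M N"
  then obtain \<phi> where f: "shift_hom s 0 M N \<phi>"
    and bij: "\<And>a. bij_betw (\<phi> a) (pspace M a) (pspace N a)"
    unfolding pers_iso_def by blast
  define \<psi> where "\<psi> a = inv_into (pspace M a) (\<phi> a)" for a
  have l: "\<psi> a (\<phi> a x) = x" if "x \<in> pspace M a" for a x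
    using bij_betw_inv_into_left[OF bij that] by (simp add: \<psi>_def)
  have r: "\<phi> a (\<psi> a y) = y" "\<psi> a y \<in> pspace M a" if "y \<in> pspace N a" for a y
    using bij_betw_inv_into_right[OF bij that] bij_betw_apply[OF bij_betw_inv_into[OF bij] that]
    by (simp_all add: \<psi>_def)
  have eq: "\<psi> a y = x" if "x \<in> pspace M a" "y = \<phi> a x" for a x y
    using l that by simp
  have sub: "subspace (pspace M a)" for a by (rule pers_moduleD(1)[OF M])
  have g: "shift_hom s 0 N M \<psi>"
    unfolding shift_hom_def linear_map_on_def
  proof (intro conjI allI impI ballI)
    fix a
    show "\<psi> a \<in> pspace N a \<rightarrow> pspace M (a + 0)" using r by simp
    fix b y assume "a \<le> b" and y: "y \<in> pspace N a"
    show "\<psi> b (pmap N a b y) = pmap M (a + 0) (b + 0) (\<psi> a y)"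
      using shift_homD(3)[OF f \<open>a \<le> b\<close> r(2)[OF y]] r[OF y] pmap_in[OF M \<open>a \<le> b\<close>]
      by (intro eq) simp_all
  next
    fix a y z assume y: "y \<in> pspace N a" and z: "z \<in> pspace N a"
    have "\<psi> a y + \<psi> a z \<in> pspace M a"
      by (rule subspace_add[OF sub r(2)[OF y] r(2)[OF z]])
    then show "\<psi> a (y + z) = \<psi> a y + \<psi> a z"
      using linear_map_onD(2)[OF shift_homD(1)[OF f] r(2)[OF y] r(2)[OF z]] r y z
      by (intro eq) simp_all
  next
    fix a c y assume y: "y \<in> pspace N a"
    have "s c (\<psi> a y) \<in> pspace M a"
      by (rule subspace_scale[OF sub r(2)[OF y]])
    then show "\<psi> a (s c y) = s c (\<psi> a y)"
      using linear_map_onD(3)[OF shift_homD(1)[OF f] r(2)[OF y]] r y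
      by (intro eq) simp_all
  qed
  show "interleaved s 0 M N"
    unfolding interleaved_def
    by (intro exI[of _ \<phi>] exI[of _ \<psi>])
      (simp add: f g l r pers_moduleD(3)[OF M] pers_moduleD(3)[OF N])
next
  assume "interleaved s 0 M N"
  then obtain \<phi> \<psi> where f: "shift_hom s 0 M N \<phi>" "shift_hom s 0 N M \<psi>"
    and l: "\<And>a x. x \<in> pspace M a \<Longrightarrow> \<psi> a (\<phi> a x) = x"
    and r: "\<And>a x. x \<in> pspace N a \<Longrightarrow> \<phi> a (\<psi> a x) = x"
    unfolding interleaved_def by (auto simp: pers_moduleD(3)[OF M] pers_moduleD(3)[OF N])
  have "bij_betw (\<phi> a) (pspace M a) (pspace N a)" for a
    by (rule bij_betwI[where g = "\<psi> a"])
      (use shift_homD(2)[OF f(1), of _ a] shift_homD(2)[OF f(2), of _ a] l r in auto)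
  then show "pers_iso s M N" using f unfolding pers_iso_def by blast
qed

section \<open>Shrinking a persistence module\<close>

text \<open>
  \<open>shrink r M\<close> is the image of the canonical map from \<open>M\<close> shifted by \<open>-r\<close> to \<open>M\<close> shifted by \<open>r\<close>, and
  so a submodule of the latter.
\<close>

definition shrink :: "real \<Rightarrow> 'v pers \<Rightarrow> 'v pers" where
  "shrink r M =
     \<lparr> pspace = (\<lambda>a. pmap M (a - r) (a + r) ` pspace M (a - r)),
       pmap = (\<lambda>a b. pmap M (a + r) (b + r)) \<rparr>"

lemma pspace_shrink: "pspace (shrink r M) a = pmap M (a - r) (a + r) ` pspace M (a - r)"
  and pmap_shrink: "pmap (shrink r M) a b = pmap M (a + r) (b + r)"
  by (simp_all add: shrink_def)

lemma pspace_shrink_subset: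
  "pers_module s M \<Longrightarrow> 0 \<le> r \<Longrightarrow> pspace (shrink r M) a \<subseteq> pspace M (a + r)"
  unfolding pspace_shrink by (auto intro!: pmap_in)

lemma pmap_image_shrink:
  assumes M: "pers_module s M" and "0 \<le> r" "a \<le> b"
  shows "pmap M (a + r) (b + r) ` pspace (shrink r M) a \<subseteq> pspace (shrink r M) b"
proof
  fix y assume "y \<in> pmap M (a + r) (b + r) ` pspace (shrink r M) a"
  then obtain x where x: "x \<in> pspace M (a - r)"
    and y: "y = pmap M (a + r) (b + r) (pmap M (a - r) (a + r) x)"
    unfolding pspace_shrink by blast
  have "y = pmap M (a - r) (b + r) x"
    unfolding y by (rule pers_moduleD(4)[OF M _ _ x]) (use assms in auto)
  also have "\<dots> = pmap M (b - r) (b + r) (pmap M (a - r) (b - r) x)"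
    by (rule pers_moduleD(4)[OF M _ _ x, symmetric]) (use assms in auto)
  finally show "y \<in> pspace (shrink r M) b"
    unfolding pspace_shrink using pmap_in[OF M _ x, of "b - r"] \<open>a \<le> b\<close> by simp
qed

lemma pers_module_shrink:
  assumes s: "vector_space s" and M: "pers_module s M" and r: "0 \<le> r"
  shows "pers_module s (shrink r M)"
  unfolding pers_module_def
proof (intro conjI allI impI ballI)
  note sub = subsetD[OF pspace_shrink_subset[OF M r]]
  show "module.subspace s (pspace (shrink r M) a)" for a
    unfolding pspace_shrink
    by (rule linear_map_on_image_subspace[OF s pers_moduleD(2)[OF M] pers_moduleD(1)[OF M]])
      (use r in simp)
  show "linear_map_on s (pspace (shrink r M) a) (pspace (shrink r M) b) (pmap (shrink r M) a b)"
    if "a \<le> b" for a b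
    unfolding pmap_shrink
    by (rule linear_map_on_restrict[OF pers_moduleD(2)[OF M]
          pspace_shrink_subset[OF M r] pmap_image_shrink[OF M r that]])
      (use that in simp)
  show "pmap (shrink r M) a a x = x" if "x \<in> pspace (shrink r M) a" for a x
    unfolding pmap_shrink using pers_moduleD(3)[OF M] sub[OF that] by simp
  show "pmap (shrink r M) b c (pmap (shrink r M) a b x) = pmap (shrink r M) a c x"
    if "a \<le> b" "b \<le> c" "x \<in> pspace (shrink r M) a" for a b c x
    unfolding pmap_shrink using pers_moduleD(4)[OF M _ _ sub] that by simp
qed

text \<open>
  Naturality carries the image of \<open>M(a - r) \<rightarrow> M(a + r)\<close> into the corresponding image for \<open>N\<close>; so the
  components of \<open>\<phi>\<close> need only be restricted.
\<close>

lemma shift_hom_shrink: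
  assumes M: "pers_module s M" and r: "0 \<le> r" and f: "shift_hom s e M N \<phi>"
  shows "shift_hom s e (shrink r M) (shrink r N) (\<lambda>a. \<phi> (a + r))"
  unfolding shift_hom_def
proof (intro conjI allI impI ballI)
  note sub = subsetD[OF pspace_shrink_subset[OF M r]]
  fix a
  have "\<phi> (a + r) ` pspace (shrink r M) a \<subseteq> pspace (shrink r N) (a + e)"
  proof
    fix y assume "y \<in> \<phi> (a + r) ` pspace (shrink r M) a"
    then obtain x where x: "x \<in> pspace M (a - r)"
      and y: "y = \<phi> (a + r) (pmap M (a - r) (a + r) x)"
      unfolding pspace_shrink by blast
    have "y = pmap N (a - r + e) (a + r + e) (\<phi> (a - r) x)"
      unfolding y by (rule shift_homD(3)[OF f _ x]) (use r in simp)
    then show "y \<in> pspace (shrink r N) (a + e)"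
      unfolding pspace_shrink using shift_homD(2)[OF f x] by (simp add: algebra_simps)
  qed
  then show "linear_map_on s (pspace (shrink r M) a) (pspace (shrink r N) (a + e)) (\<phi> (a + r))"
    by (rule linear_map_on_restrict[OF shift_homD(1)[OF f] pspace_shrink_subset[OF M r]])
  fix b x assume "a \<le> b" "x \<in> pspace (shrink r M) a"
  then show "\<phi> (b + r) (pmap (shrink r M) a b x)
      = pmap (shrink r N) (a + e) (b + e) (\<phi> (a + r) x)"
    unfolding pmap_shrink using shift_homD(3)[OF f _ sub, of a "b + r" x]
    by (simp add: ac_simps)
qed

lemma interleaved_shrink:
  assumes M: "pers_module s M" and N: "pers_module s N" and r: "0 \<le> r"
    and "interleaved s e M N"
  shows "interleaved s e (shrink r M) (shrink r N)"
proof -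
  obtain \<phi> \<psi> where f: "shift_hom s e M N \<phi>" "shift_hom s e N M \<psi>"
    and l: "\<And>a x. x \<in> pspace M a \<Longrightarrow> \<psi> (a + e) (\<phi> a x) = pmap M a (a + 2 * e) x"
    and r': "\<And>a x. x \<in> pspace N a \<Longrightarrow> \<phi> (a + e) (\<psi> a x) = pmap N a (a + 2 * e) x"
    using assms(4) unfolding interleaved_def by blast
  show ?thesis
    unfolding interleaved_def
  proof (intro exI conjI allI ballI)
    show "shift_hom s e (shrink r M) (shrink r N) (\<lambda>a. \<phi> (a + r))"
      by (rule shift_hom_shrink[OF M r f(1)])
    show "shift_hom s e (shrink r N) (shrink r M) (\<lambda>a. \<psi> (a + r))"
      by (rule shift_hom_shrink[OF N r f(2)])
    show "\<psi> (a + e + r) (\<phi> (a + r) x) = pmap (shrink r M) a (a + 2 * e) x"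
      if "x \<in> pspace (shrink r M) a" for a x
      using l[OF subsetD[OF pspace_shrink_subset[OF M r] that]]
      by (simp add: pmap_shrink ac_simps)
    show "\<phi> (a + e + r) (\<psi> (a + r) x) = pmap (shrink r N) a (a + 2 * e) x"
      if "x \<in> pspace (shrink r N) a" for a x
      using r'[OF subsetD[OF pspace_shrink_subset[OF N r] that]]
      by (simp add: pmap_shrink ac_simps)
  qed
qed

text \<open>
  For \<open>q = r + e\<close>, the elements that come from \<open>M(a - r)\<close> are pushed forward from \<open>M(a + r)\<close> to
  \<open>M(a + e + q)\<close>, where they still come from \<open>M(a + e - q) = M(a - r)\<close>. In the other direction no map
  is needed: \<open>M\<^sup>q(a)\<close> and \<open>M\<^sup>r(a + e)\<close> are both images in \<open>M(a + q)\<close>, and the former, which comes from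
  the earlier \<open>M(a - q)\<close>, is contained in the latter.
\<close>

lemma interleaved_shrink_le:
  assumes M: "pers_module s M" and r: "0 \<le> r" and rq: "r \<le> q"
  shows "interleaved s (q - r) (shrink r M) (shrink q M)"
proof -
  define e where "e = q - r"
  have e: "0 \<le> e" and q: "q = r + e" and q0: "0 \<le> q" using r rq by (auto simp: e_def)
  note subr = subsetD[OF pspace_shrink_subset[OF M r]]
  note subq = subsetD[OF pspace_shrink_subset[OF M q0]]
  have 1: "shift_hom s e (shrink r M) (shrink q M) (\<lambda>a. pmap M (a + r) (a + e + q))"
    unfolding shift_hom_def
  proof (intro conjI allI impI ballI)
    fix a
    have im: "pmap M (a + r) (a + e + q) ` pspace (shrink r M) a \<subseteq> pspace (shrink q M) (a + e)"
    proof
      fix y assume "y \<in> pmap M (a + r) (a + e + q) ` pspace (shrink r M) a"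
      then obtain x where x: "x \<in> pspace M (a - r)"
        and y: "y = pmap M (a + r) (a + e + q) (pmap M (a - r) (a + r) x)"
        unfolding pspace_shrink by blast
      have "y = pmap M (a - r) (a + e + q) x"
        unfolding y by (rule pers_moduleD(4)[OF M _ _ x]) (use r e q in auto)
      then show "y \<in> pspace (shrink q M) (a + e)"
        unfolding pspace_shrink using x by (simp add: q)
    qed
    show "linear_map_on s (pspace (shrink r M) a) (pspace (shrink q M) (a + e))
        (pmap M (a + r) (a + e + q))"
      by (rule linear_map_on_restrict[OF pers_moduleD(2)[OF M] pspace_shrink_subset[OF M r] im])
        (use e q in simp)
    fix b x assume ab: "a \<le> b" and x: "x \<in> pspace (shrink r M) a"
    show "pmap M (b + r) (b + e + q) (pmap (shrink r M) a b x)
        = pmap (shrink q M) (a + e) (b + e) (pmap M (a + r) (a + e + q) x)"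
      unfolding pmap_shrink
      using pers_moduleD(4)[OF M _ _ subr[OF x], of "b + r" "b + e + q"]
        pers_moduleD(4)[OF M _ _ subr[OF x], of "a + e + q" "b + e + q"] ab e q by simp
  qed
  have 2: "shift_hom s e (shrink q M) (shrink r M) (\<lambda>a x. x)"
    unfolding shift_hom_def
  proof (intro conjI allI impI ballI)
    fix a
    have "pspace (shrink q M) a \<subseteq> pspace (shrink r M) (a + e)"
    proof
      fix y assume "y \<in> pspace (shrink q M) a"
      then obtain x where x: "x \<in> pspace M (a - q)" and y: "y = pmap M (a - q) (a + q) x"
        unfolding pspace_shrink by blast
      have "pmap M (a + e - r) (a + q) (pmap M (a - q) (a + e - r) x) = y"
        unfolding y by (rule pers_moduleD(4)[OF M _ _ x]) (use r e q in auto)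
      moreover have "pmap M (a - q) (a + e - r) x \<in> pspace M (a + e - r)"
        by (rule pmap_in[OF M _ x]) (use e q in simp)
      ultimately show "y \<in> pspace (shrink r M) (a + e)"
        unfolding pspace_shrink by (force simp: q ac_simps)
    qed
    then show "linear_map_on s (pspace (shrink q M) a) (pspace (shrink r M) (a + e)) (\<lambda>x. x)"
      by (auto simp: linear_map_on_def)
    show "pmap (shrink q M) a b x = pmap (shrink r M) (a + e) (b + e) x" for b x
      by (simp add: pmap_shrink q ac_simps)
  qed
  have "interleaved s e (shrink r M) (shrink q M)"
    unfolding interleaved_def
    by (intro exI conjI, rule 1, rule 2) (simp_all add: pmap_shrink q ac_simps)
  then show ?thesis by (simp add: e_def)
qed

lemma interleaved_shrink_shrink:
  assumes s: "vector_space s" and M: "pers_module s M" and N: "pers_module s N"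
    and r: "0 \<le> r" and q: "0 \<le> q" and e: "0 \<le> e" and MN: "interleaved s e M N"
  shows "interleaved s (e + \<bar>r - q\<bar>) (shrink r M) (shrink q N)"
proof (rule interleaved_trans[OF pers_module_shrink[OF s M r] pers_module_shrink[OF s N q] e])
  show "interleaved s e (shrink r M) (shrink r N)"
    by (rule interleaved_shrink[OF M N r MN])
  show "interleaved s \<bar>r - q\<bar> (shrink r N) (shrink q N)"
    using interleaved_shrink_le[OF N r, of q] interleaved_sym[OF interleaved_shrink_le[OF N q, of r]]
    by (cases "r \<le> q") simp_all
qed simp

lemma shrink_0:
  assumes "pers_module s M"
  shows "shrink 0 M = M"
proof (rule pers.equality)
  show "pspace (shrink 0 M) = pspace M"
    by (rule ext) (use pers_moduleD(3)[OF assms] in \<open>force simp: pspace_shrink\<close>)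
qed (simp_all add: pmap_shrink fun_eq_iff)


section \<open>Isomorphism classes\<close>

lemma interleaved_0_refl: "pers_module s M \<Longrightarrow> interleaved s 0 M M"
  unfolding interleaved_def
  by (intro exI[of _ "\<lambda>a x. x"])
    (simp add: shift_hom_def linear_map_on_def pers_moduleD(3))

lemma iso_class_iff:
  fixes M :: "'k::field rpers"
  assumes "pers_module rscale M"
  shows "N \<in> iso_class M \<longleftrightarrow> pers_module rscale N \<and> interleaved rscale 0 M N"
  using pers_iso_iff_interleaved_0[OF vector_space_rscale assms] unfolding iso_class_def by blast

lemma iso_class_self:
  fixes M :: "'k::field rpers"
  shows "pers_module rscale M \<Longrightarrow> M \<in> iso_class M"
  by (simp add: iso_class_iff interleaved_0_refl)

lemma iso_class_eqI:
  fixes M N :: "'k::field rpers"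
  assumes M: "pers_module rscale M" and N: "pers_module rscale N"
    and MN: "interleaved rscale 0 M N"
  shows "iso_class M = iso_class N"
proof -
  have "interleaved rscale 0 M P \<longleftrightarrow> interleaved rscale 0 N P" if P: "pers_module rscale P" for P
    using interleaved_trans[OF M P _ _ MN] interleaved_trans[OF N P _ _ interleaved_sym[OF MN]]
    by auto
  then show ?thesis by (auto simp: iso_class_iff[OF M] iso_class_iff[OF N])
qed

lemma pers_module_zero_module: "pers_module rscale (zero_module :: 'k::field rpers)"
  using pers_module_interval_sum[of "{}" "\<lambda>_. {}"]
  by (simp add: interval_sum_empty interval_family_def)

lemma pers_module_zero_in:
  fixes M :: "'k::field rpers"
  shows "pers_module rscale M \<Longrightarrow> 0 \<in> pspace M a"
  using module.subspace_0[of rscale] pers_moduleD(1) vector_space_rscale module_iff_vector_space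
  by blast

lemma pmap_zero:
  fixes M :: "'k::field rpers"
  shows "pers_module rscale M \<Longrightarrow> a \<le> b \<Longrightarrow> pmap M a b 0 = 0"
  using linear_map_on_zero[OF vector_space_rscale pers_moduleD(2) pers_module_zero_in] by blast

text \<open>
  Every map to or from the zero module vanishes, so an interleaving only says that the round trips
  through it, which are the transition maps of length \<open>2 e\<close>, are zero.
\<close>

lemma interleaved_zero_iff:
  fixes M :: "'k::field rpers"
  assumes M: "pers_module rscale M" and e: "0 \<le> e"
  shows "interleaved rscale e zero_module M \<longleftrightarrow>
    (\<forall>a. \<forall>x\<in>pspace M a. pmap M a (a + 2 * e) x = 0)"
proof
  assume "interleaved rscale e zero_module M"
  then obtain \<phi> \<psi> where f: "shift_hom rscale e (zero_module :: 'k rpers) M \<phi>"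
    "shift_hom rscale e M zero_module \<psi>"
    "\<And>a x. x \<in> pspace M a \<Longrightarrow> \<phi> (a + e) (\<psi> a x) = pmap M a (a + 2 * e) x"
    unfolding interleaved_def by blast
  have "\<psi> a x = 0" if "x \<in> pspace M a" for a x
    using shift_homD(2)[OF f(2) that] by (simp add: zero_module_def)
  moreover have "\<phi> a 0 = 0" for a
    by (rule linear_map_on_zero[OF vector_space_rscale shift_homD(1)[OF f(1)]])
      (simp add: zero_module_def)
  ultimately show "\<forall>a. \<forall>x\<in>pspace M a. pmap M a (a + 2 * e) x = 0"
    using f(3) by force
next
  assume "\<forall>a. \<forall>x\<in>pspace M a. pmap M a (a + 2 * e) x = 0"
  moreover have "shift_hom rscale e (zero_module :: 'k rpers) M (\<lambda>_ _. 0)"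
    "shift_hom rscale e M (zero_module :: 'k rpers) (\<lambda>_ _. 0)"
    by (auto simp: shift_hom_def linear_map_on_def zero_module_def pers_module_zero_in[OF M]
        pmap_zero[OF M] pointwise_scale_def fun_eq_iff)
  ultimately show "interleaved rscale e zero_module M"
    unfolding interleaved_def
    by (intro exI[of _ "\<lambda>_ _. 0"]) (simp add: zero_module_def)
qed

text \<open>
  \<open>M\<^sup>r(a)\<close> is the image of a transition map of length \<open>2 r\<close>, which factors through one of length
  \<open>2 e\<close>.
\<close>

lemma iso_class_shrink_eq_zero:
  fixes M :: "'k::field rpers"
  assumes M: "pers_module rscale M" and e: "0 \<le> e" "e \<le> r"
    and z: "interleaved rscale e zero_module M"
  shows "iso_class (shrink r M) = zero_iso_class"
proof -
  have r: "0 \<le> r" using e by simp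
  have kill: "pmap M (a - r) (a + r) y = 0" if y: "y \<in> pspace M (a - r)" for a y
  proof -
    have "pmap M (a - r) (a + r) y
        = pmap M (a - r + 2 * e) (a + r) (pmap M (a - r) (a - r + 2 * e) y)"
      by (rule pers_moduleD(4)[OF M _ _ y, symmetric]) (use e in auto)
    also have "\<dots> = 0"
      using z y e unfolding interleaved_zero_iff[OF M e(1)] by (simp add: pmap_zero[OF M])
    finally show ?thesis .
  qed
  note S = pers_module_shrink[OF vector_space_rscale M r]
  have "interleaved rscale 0 zero_module (shrink r M)"
    unfolding interleaved_zero_iff[OF S order_refl]
    by (auto simp: pspace_shrink pmap_shrink kill intro: pmap_zero[OF M])
  then show ?thesis
    unfolding zero_iso_class_def
    by (rule iso_class_eqI[OF pers_module_zero_module S, symmetric])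
qed

text \<open>
  The union over all representatives replaces a choice of one; all of them give the same class
  (\<open>shrink_class_iso_class\<close>).
\<close>

definition shrink_class :: "real \<Rightarrow> 'k::field rpers set \<Rightarrow> 'k rpers set" where
  "shrink_class r X = (\<Union>M\<in>X. iso_class (shrink r M))"

lemma shrink_class_iso_class:
  fixes M :: "'k::field rpers"
  assumes M: "pers_module rscale M" and r: "0 \<le> r"
  shows "shrink_class r (iso_class M) = iso_class (shrink r M)"
proof -
  have "iso_class (shrink r N) = iso_class (shrink r M)" if "N \<in> iso_class M" for N
  proof -
    from that have N: "pers_module rscale N" and MN: "interleaved rscale 0 M N"
      by (simp_all add: iso_class_iff[OF M])
    show ?thesis
      using iso_class_eqI[OF pers_module_shrink[OF vector_space_rscale M r]
          pers_module_shrink[OF vector_space_rscale N r] interleaved_shrink[OF M N r MN]]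
      by simp
  qed
  then show ?thesis
    unfolding shrink_class_def using iso_class_self[OF M] by blast
qed

text \<open>
  The infimum over all representatives can be tested on given ones, because an interleaving composed
  with \<open>0\<close>-interleavings keeps its parameter. All arguments about the distance go through this
  criterion.
\<close>

lemma interleaving_dist_less_iff:
  fixes M N :: "'k::field rpers"
  assumes M: "pers_module rscale M" and N: "pers_module rscale N"
  shows "interleaving_dist (iso_class M) (iso_class N) < r \<longleftrightarrow>
    (\<exists>e\<ge>0. ennreal e < r \<and> interleaved rscale e M N)"
proof
  assume "interleaving_dist (iso_class M) (iso_class N) < r"
  then obtain e M' N' where e: "0 \<le> e" "ennreal e < r" and M': "M' \<in> iso_class M"
    and N': "N' \<in> iso_class N" and i: "interleaved rscale e M' N'"
    unfolding interleaving_dist_def Inf_less_iff by blast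
  have "pers_module rscale N'" and MM: "interleaved rscale 0 M M'"
    and NN: "interleaved rscale 0 N' N"
    using M' N' by (simp_all add: iso_class_iff[OF M] iso_class_iff[OF N] interleaved_sym)
  then have "interleaved rscale (0 + e + 0) M N"
    using interleaved_trans[OF M _ order_refl e(1) MM i] interleaved_trans[OF M N _ order_refl _ NN]
      e by simp
  then show "\<exists>e\<ge>0. ennreal e < r \<and> interleaved rscale e M N" using e by auto
next
  assume "\<exists>e\<ge>0. ennreal e < r \<and> interleaved rscale e M N"
  then show "interleaving_dist (iso_class M) (iso_class N) < r"
    unfolding interleaving_dist_def Inf_less_iff
    using iso_class_self[OF M] iso_class_self[OF N] by blast
qed

section \<open>The contraction\<close>

text \<open>The only properties of the five classes that the contraction requires.\<close>

definition shrink_closed :: "'k::field rpers set set \<Rightarrow> bool" where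
  "shrink_closed S \<longleftrightarrow> zero_iso_class \<in> S \<and>
     (\<forall>X\<in>S. (\<exists>M. pers_module rscale M \<and> X = iso_class M) \<and> (\<forall>r\<ge>0. shrink_class r X \<in> S))"

definition finite_part :: "'k::field rpers set set \<Rightarrow> 'k rpers set set" where
  "finite_part S = {X \<in> S. interleaving_dist zero_iso_class X < \<infinity>}"

lemma finite_part_iff:
  fixes M :: "'k::field rpers"
  assumes M: "pers_module rscale M"
  shows "iso_class M \<in> finite_part S \<longleftrightarrow>
    iso_class M \<in> S \<and> (\<exists>e\<ge>0. interleaved rscale e zero_module M)"
  unfolding finite_part_def zero_iso_class_def mem_Collect_eq
    interleaving_dist_less_iff[OF pers_module_zero_module M] by simp

lemma shrink_closedE:
  assumes "shrink_closed S" and "X \<in> S"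
  obtains M where "pers_module rscale M" and "X = iso_class M"
  using assms unfolding shrink_closed_def by blast

lemma finite_part_near:
  fixes M N :: "'k::field rpers"
  assumes M: "pers_module rscale M" and N: "pers_module rscale N"
    and fM: "iso_class M \<in> finite_part S" and NS: "iso_class N \<in> S"
    and e: "0 \<le> e" "interleaved rscale e M N"
  shows "iso_class N \<in> finite_part S"
proof -
  obtain d where "0 \<le> d" "interleaved rscale d zero_module M"
    using fM by (auto simp: finite_part_iff[OF M])
  then have "interleaved rscale (d + e) zero_module N"
    using interleaved_trans[OF pers_module_zero_module N] e by blast
  then show ?thesis
    using NS \<open>0 \<le> d\<close> e(1) unfolding finite_part_iff[OF N] by (blast intro: add_nonneg_nonneg)
qed

lemma shrink_closed_finite_part:
  fixes S :: "'k::field rpers set set"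
  assumes S: "shrink_closed S"
  shows "shrink_closed (finite_part S)"
  unfolding shrink_closed_def
proof (intro conjI ballI allI impI)
  have "zero_iso_class \<in> S" using S by (simp add: shrink_closed_def)
  then show "zero_iso_class \<in> finite_part S"
    using interleaved_0_refl[OF pers_module_zero_module]
    unfolding zero_iso_class_def finite_part_iff[OF pers_module_zero_module] by blast
  fix X :: "'k rpers set"
  assume X: "X \<in> finite_part S"
  then have XS: "X \<in> S" by (simp add: finite_part_def)
  then show "\<exists>M. pers_module rscale M \<and> X = iso_class M"
    using S unfolding shrink_closed_def by blast
  then obtain M where M: "pers_module rscale M" "X = iso_class M" by blast
  fix r :: real assume r: "0 \<le> r"
  have "interleaved rscale r M (shrink r M)"
    using interleaved_shrink_le[OF M(1) order_refl r] by (simp add: shrink_0[OF M(1)])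
  moreover have "iso_class (shrink r M) \<in> S"
    using S XS r unfolding shrink_closed_def M(2) by (metis shrink_class_iso_class[OF M(1) r])
  ultimately show "shrink_class r X \<in> finite_part S"
    using finite_part_near[OF M(1) pers_module_shrink[OF vector_space_rscale M(1) r]] X r
    by (simp add: M(2) shrink_class_iso_class[OF M(1) r])
qed

text \<open>
  That open balls are open is the triangle inequality for isomorphism classes.
\<close>

lemma openin_ball:
  fixes S :: "'k::field rpers set set"
  assumes S: "shrink_closed S" and X: "X \<in> S"
  shows "openin (interleaving_topology S) {Y\<in>S. interleaving_dist X Y < ennreal r}"
  unfolding openin_interleaving_topology
proof (intro conjI ballI)
  obtain M where M: "pers_module rscale M" "X = iso_class M" using shrink_closedE[OF S X] .
  fix Y assume "Y \<in> {Y\<in>S. interleaving_dist X Y < ennreal r}"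
  then have "Y \<in> S" and XY: "interleaving_dist X Y < ennreal r" by simp_all
  obtain N where N: "pers_module rscale N" "Y = iso_class N" using shrink_closedE[OF S \<open>Y \<in> S\<close>] .
  obtain e where e: "0 \<le> e" "e < r" "interleaved rscale e M N"
    using XY unfolding M(2) N(2) interleaving_dist_less_iff[OF M(1) N(1)]
    by (auto simp: ennreal_less_iff)
  have "interleaving_dist X Z < ennreal r" if ZS: "Z \<in> S" and YZ: "interleaving_dist Y Z < ennreal (r - e)" for Z
  proof -
    obtain P where P: "pers_module rscale P" "Z = iso_class P" using shrink_closedE[OF S ZS] .
    obtain d where d: "0 \<le> d" "d < r - e" "interleaved rscale d N P"
      using YZ unfolding P(2) N(2) interleaving_dist_less_iff[OF N(1) P(1)]
      by (auto simp: ennreal_less_iff)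
    have "interleaved rscale (e + d) M P"
      by (rule interleaved_trans[OF M(1) P(1) e(1) d(1) e(3) d(3)])
    moreover have "ennreal (e + d) < ennreal r"
      using d e by (intro ennreal_lessI) auto
    ultimately show ?thesis
      unfolding M(2) P(2) interleaving_dist_less_iff[OF M(1) P(1)]
      using d(1) e(1) by (intro exI[of _ "e + d"]) auto
  qed
  then show "\<exists>q>0. {Z\<in>S. interleaving_dist Y Z < ennreal q}
      \<subseteq> {Y\<in>S. interleaving_dist X Y < ennreal r}"
    using e(2) by (intro exI[of _ "r - e"]) auto
qed blast

text \<open>
  The distance to zero is finite on all or on none of a ball of radius \<open>1\<close>.
\<close>

lemma finite_part_clopen:
  fixes S :: "'k::field rpers set set"
  assumes S: "shrink_closed S"
  shows "openin (interleaving_topology S) (finite_part S)"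
    and "closedin (interleaving_topology S) (finite_part S)"
proof -
  have same: "Y \<in> finite_part S \<longleftrightarrow> X \<in> finite_part S"
    if XS: "X \<in> S" and YS: "Y \<in> S" and XY: "interleaving_dist X Y < ennreal 1" for X Y
  proof -
    obtain M where M: "pers_module rscale M" "X = iso_class M" using shrink_closedE[OF S XS] .
    obtain N where N: "pers_module rscale N" "Y = iso_class N" using shrink_closedE[OF S YS] .
    obtain e where e: "0 \<le> e" "interleaved rscale e M N"
      using XY unfolding M(2) N(2) interleaving_dist_less_iff[OF M(1) N(1)] by blast
    show ?thesis
      using finite_part_near[OF M(1) N(1) _ _ e, of S] finite_part_near[OF N(1) M(1) _ _ e(1)
          interleaved_sym[OF e(2)], of S] XS YS
      by (auto simp: M(2) N(2))
  qed
  have sub: "finite_part S \<subseteq> S" by (auto simp: finite_part_def)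
  show "openin (interleaving_topology S) (finite_part S)"
    unfolding openin_interleaving_topology
    using same sub by (intro conjI ballI exI[of _ 1]) auto
  have "openin (interleaving_topology S) (S - finite_part S)"
    unfolding openin_interleaving_topology
    using same sub by (intro conjI ballI exI[of _ 1]) auto
  then show "closedin (interleaving_topology S) (finite_part S)"
    using sub by (simp add: closedin_def)
qed

text \<open>
  A small enough ball around a point of the finite part stays in the finite part, since that is open;
  so it does not matter whether the balls are taken in \<open>S\<close> or in the finite part.
\<close>

lemma subtopology_finite_part:
  fixes S :: "'k::field rpers set set"
  assumes S: "shrink_closed S"
  shows "subtopology (interleaving_topology S) (finite_part S)
    = interleaving_topology (finite_part S)"
proof (rule topology_eq[THEN iffD2], intro allI)
  fix U
  let ?F = "finite_part S"
  have sub: "?F \<subseteq> S" by (auto simp: finite_part_def)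
  show "openin (subtopology (interleaving_topology S) ?F) U \<longleftrightarrow>
      openin (interleaving_topology ?F) U"
  proof
    assume "openin (subtopology (interleaving_topology S) ?F) U"
    then show "openin (interleaving_topology ?F) U"
      unfolding openin_open_subtopology[OF finite_part_clopen(1)[OF S]]
      unfolding openin_interleaving_topology using sub by blast
  next
    assume U: "openin (interleaving_topology ?F) U"
    have "\<exists>r>0. {Y\<in>S. interleaving_dist X Y < ennreal r} \<subseteq> U" if X: "X \<in> U" for X
    proof -
      obtain r where r: "r > 0" "{Y\<in>?F. interleaving_dist X Y < ennreal r} \<subseteq> U"
        using U X unfolding openin_interleaving_topology by blast
      obtain q where q: "q > 0" "{Y\<in>S. interleaving_dist X Y < ennreal q} \<subseteq> ?F"
        using finite_part_clopen(1)[OF S] U X unfolding openin_interleaving_topology by blast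
      have "ennreal (min r q) \<le> ennreal r" "ennreal (min r q) \<le> ennreal q"
        by (auto intro: ennreal_leI)
      then have "{Y\<in>S. interleaving_dist X Y < ennreal (min r q)} \<subseteq> U"
        using r(2) q(2) order.strict_trans2 by blast
      then show ?thesis using r(1) q(1) by (intro exI[of _ "min r q"]) simp
    qed
    then show "openin (subtopology (interleaving_topology S) ?F) U"
      unfolding openin_open_subtopology[OF finite_part_clopen(1)[OF S]]
      using U sub unfolding openin_interleaving_topology by blast
  qed
qed

definition contraction :: "real \<times> 'k::field rpers set \<Rightarrow> 'k rpers set" where
  "contraction = (\<lambda>(t, X). if t = 1 then zero_iso_class else shrink_class (t / (1 - t)) X)"

text \<open>
  For \<open>t < 1\<close> this is the Lipschitz estimate together with the continuity of \<open>t / (1 - t)\<close>. At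
  \<open>t = 1\<close> the contraction is constant near \<open>(1, X)\<close>, because \<open>X\<close> is at finite distance from zero.
\<close>

lemma continuous_contraction:
  fixes S :: "'k::field rpers set set"
  assumes S: "shrink_closed S" and fin: "finite_part S = S"
  shows "continuous_map (prod_topology (top_of_set {0..1}) (interleaving_topology S))
    (interleaving_topology S) contraction"
  unfolding continuous_map_def
proof (intro conjI allI impI)
  have mem: "contraction (t, X) \<in> S" if "t \<in> {0..1}" "X \<in> S" for t X
    using S that unfolding contraction_def shrink_closed_def by simp
  then show "contraction \<in> topspace (prod_topology (top_of_set {0..1}) (interleaving_topology S))
      \<rightarrow> topspace (interleaving_topology S)" by auto
  fix U assume U: "openin (interleaving_topology S) U"
  show "openin (prod_topology (top_of_set {0..1}) (interleaving_topology S))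
      {p \<in> topspace (prod_topology (top_of_set {0..1}) (interleaving_topology S)).
        contraction p \<in> U}"
    unfolding openin_prod_topology_alt
  proof (intro allI impI)
    fix t :: real and X :: "'k rpers set"
    assume "(t, X) \<in> {p \<in> topspace (prod_topology (top_of_set {0..1}) (interleaving_topology S)).
        contraction p \<in> U}"
    then have t: "0 \<le> t" "t \<le> 1" and X: "X \<in> S" and XU: "contraction (t, X) \<in> U" by auto
    obtain M where M: "pers_module rscale M" "X = iso_class M" using shrink_closedE[OF S X] .
    have "\<exists>V r. openin (top_of_set {0..1}) V \<and> t \<in> V \<and> r > 0 \<and>
      (\<forall>u\<in>V. \<forall>Y\<in>S. interleaving_dist X Y < ennreal r \<longrightarrow> contraction (u, Y) \<in> U)"
    proof (cases "t = 1")
      case True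
      obtain e where e: "0 \<le> e" "interleaved rscale e zero_module M"
        using X fin unfolding M(2) by (metis finite_part_iff[OF M(1)])
      \<comment> \<open>For \<open>u < 1\<close>, the inequality \<open>(e + 1) / (e + 2) < u\<close> is equivalent to \<open>e + 1 < u / (1 - u)\<close>;
        and \<open>e + 1\<close> exceeds the interleaving parameter with zero of every \<open>Y\<close> in the ball of
        radius \<open>1\<close> around \<open>X\<close>.\<close>
      define V where "V = {0..1} \<inter> {(e + 1) / (e + 2)<..}"
      have "contraction (u, Y) = zero_iso_class"
        if u: "u \<in> V" and Y: "Y \<in> S" and XY: "interleaving_dist X Y < ennreal 1" for u Y
      proof (cases "u = 1")
        case False
        obtain N where N: "pers_module rscale N" "Y = iso_class N" using shrink_closedE[OF S Y] .
        obtain d where d: "0 \<le> d" "d < 1" "interleaved rscale d M N"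
          using XY unfolding M(2) N(2) interleaving_dist_less_iff[OF M(1) N(1)]
          by (metis ennreal_less_iff)
        have u1: "u < 1" "(e + 1) / (e + 2) < u" using u False by (auto simp: V_def)
        then have large: "e + 1 < u / (1 - u)" using e by (simp add: field_simps)
        have "interleaved rscale (e + d) zero_module N"
          by (rule interleaved_trans[OF pers_module_zero_module N(1) e(1) d(1) e(2) d(3)])
        then have "iso_class (shrink (u / (1 - u)) N) = zero_iso_class"
          by (rule iso_class_shrink_eq_zero[OF N(1), rotated 2]) (use d e large in simp_all)
        then show ?thesis
          using False large e by (simp add: contraction_def N(2) shrink_class_iso_class[OF N(1)])
      qed (simp add: contraction_def)
      moreover have "zero_iso_class \<in> U" using XU True by (simp add: contraction_def)
      moreover have "openin (top_of_set {0..1}) V" unfolding V_def by (simp add: openin_open_Int)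
      moreover have "t \<in> V" using True e by (simp add: V_def)
      ultimately show ?thesis by (intro exI[of _ V] exI[of _ 1]) simp
    next
      case False
      define g where "g u = u / (1 - u)" for u :: real
      have g0: "0 \<le> g u" if "0 \<le> u" "u < 1" for u using that by (simp add: g_def)
      have t1: "t < 1" using t False by simp
      have eq: "contraction (u, iso_class N) = iso_class (shrink (g u) N)"
        if "0 \<le> u" "u < 1" "pers_module rscale N" for u and N :: "'k rpers"
        using that g0[of u] by (simp add: contraction_def g_def shrink_class_iso_class)
      obtain r where r: "r > 0" "{Y\<in>S. interleaving_dist (contraction (t, X)) Y < ennreal r} \<subseteq> U"
        using U XU unfolding openin_interleaving_topology by blast
      have "isCont g t" unfolding g_def using t1 by (intro continuous_intros) simp
      then obtain \<delta> where \<delta>: "\<delta> > 0" "\<And>u. \<bar>u - t\<bar> < \<delta> \<Longrightarrow> \<bar>g u - g t\<bar> < r / 2"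
        using r(1) unfolding continuous_at_eps_delta dist_real_def by (metis half_gt_zero)
      \<comment> \<open>The bound \<open>1 - t\<close> on the radius keeps the point \<open>1\<close>, where \<open>g\<close> is singular, out of \<open>V\<close>.\<close>
      define V where "V = {0..1} \<inter> ball t (min \<delta> (1 - t))"
      have "contraction (u, Y) \<in> U"
        if u: "u \<in> V" and Y: "Y \<in> S" and XY: "interleaving_dist X Y < ennreal (r / 2)" for u Y
      proof -
        have u': "0 \<le> u" "u < 1" "\<bar>u - t\<bar> < \<delta>" using u by (auto simp: V_def dist_real_def)
        obtain N where N: "pers_module rscale N" "Y = iso_class N" using shrink_closedE[OF S Y] .
        obtain d where d: "0 \<le> d" "d < r / 2" "interleaved rscale d M N"
          using XY unfolding M(2) N(2) interleaving_dist_less_iff[OF M(1) N(1)]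
          by (metis ennreal_less_iff)
        have gt: "0 \<le> g t" and gu: "0 \<le> g u" using g0 t t1 u' by auto
        have "interleaved rscale (d + \<bar>g t - g u\<bar>) (shrink (g t) M) (shrink (g u) N)"
          by (rule interleaved_shrink_shrink[OF vector_space_rscale M(1) N(1) gt gu d(1,3)])
        moreover have "ennreal (d + \<bar>g t - g u\<bar>) < ennreal r"
          using d \<delta>(2)[OF u'(3)] r(1) by (intro ennreal_lessI) (simp_all add: abs_minus_commute)
        ultimately have "interleaving_dist (contraction (t, X)) (contraction (u, Y)) < ennreal r"
          unfolding M(2) N(2) eq[OF t(1) t1 M(1)] eq[OF u'(1,2) N(1)]
            interleaving_dist_less_iff[OF pers_module_shrink[OF vector_space_rscale M(1) gt]
              pers_module_shrink[OF vector_space_rscale N(1) gu]]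
          using d(1) by (intro exI[of _ "d + \<bar>g t - g u\<bar>"]) simp
        then show ?thesis using r(2) mem[of u Y] u'(1,2) Y by auto
      qed
      moreover have "openin (top_of_set {0..1}) V" unfolding V_def by (simp add: openin_open_Int)
      moreover have "t \<in> V" using t t1 \<delta>(1) by (simp add: V_def)
      ultimately show ?thesis using r(1) by (intro exI[of _ V] exI[of _ "r / 2"]) simp
    qed
    then obtain V r where V: "openin (top_of_set {0..1}) V" "t \<in> V" and r: "r > 0"
      and VU: "\<And>u Y. u \<in> V \<Longrightarrow> Y \<in> S \<Longrightarrow> interleaving_dist X Y < ennreal r \<Longrightarrow> contraction (u, Y) \<in> U"
      by blast
    have "interleaving_dist X X < ennreal r"
      unfolding M(2) interleaving_dist_less_iff[OF M(1) M(1)]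
      using r interleaved_0_refl[OF M(1)] by (intro exI[of _ 0]) simp
    moreover have "V \<subseteq> {0..1}" using openin_imp_subset[OF V(1)] .
    ultimately show "\<exists>V W. openin (top_of_set {0..1}) V \<and> openin (interleaving_topology S) W \<and>
        t \<in> V \<and> X \<in> W \<and> V \<times> W \<subseteq> {p \<in> topspace (prod_topology (top_of_set {0..1})
          (interleaving_topology S)). contraction p \<in> U}"
      using V openin_ball[OF S X, of r] X VU
      by (intro exI[of _ V] exI[of _ "{Y\<in>S. interleaving_dist X Y < ennreal r}"]) auto
  qed
qed

lemma contraction_0:
  assumes "shrink_closed S" and "X \<in> S"
  shows "contraction (0, X) = X"
proof -
  obtain M where M: "pers_module rscale M" "X = iso_class M" using shrink_closedE[OF assms] .
  show ?thesis
    by (simp add: contraction_def M(2) shrink_class_iso_class[OF M(1)] shrink_0[OF M(1)])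
qed

lemma contraction_1: "contraction (1, X) = zero_iso_class"
  by (simp add: contraction_def)

lemma contractible_interleaving_topology:
  fixes S :: "'k::field rpers set set"
  assumes S: "shrink_closed S" and fin: "finite_part S = S"
  shows "contractible_to (interleaving_topology S) zero_iso_class"
  unfolding contractible_to_def
proof
  show "zero_iso_class \<in> topspace (interleaving_topology S)"
    using S by (simp add: shrink_closed_def)
  have "homotopic_with (\<lambda>_. True) (interleaving_topology S) (interleaving_topology S)
      (\<lambda>X. contraction (0, X)) (\<lambda>X. contraction (1, X))"
    unfolding homotopic_with_def using continuous_contraction[OF S fin] by blast
  then show "homotopic_with (\<lambda>_. True) (interleaving_topology S) (interleaving_topology S)
      id (\<lambda>_. zero_iso_class)"
    by (rule homotopic_with_eq) (simp_all add: contraction_0[OF S] contraction_1)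
qed

text \<open>
  A path component is connected, so it cannot leave the clopen finite part. Conversely,
  \<open>t \<mapsto> contraction (t, X)\<close> is a path from \<open>X\<close> to zero when \<open>X\<close> has finite distance to zero.
\<close>

lemma path_component_zero:
  fixes S :: "'k::field rpers set set"
  assumes S: "shrink_closed S"
  shows "path_component_of_set (interleaving_topology S) zero_iso_class = finite_part S"
proof
  let ?T = "interleaving_topology S" and ?C = "path_component_of_set (interleaving_topology S) zero_iso_class"
  have F: "shrink_closed (finite_part S)" by (rule shrink_closed_finite_part[OF S])
  then have zF: "zero_iso_class \<in> finite_part S" by (simp add: shrink_closed_def)
  have zC: "zero_iso_class \<in> ?C"
    using S by (simp add: path_component_of_refl shrink_closed_def)
  have "connectedin ?T ?C"
    by (intro path_connectedin_imp_connectedin path_connectedin_path_component_of)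
  then show "?C \<subseteq> finite_part S"
    using connectedin_clopen_cases[OF _ finite_part_clopen(2)[OF S] finite_part_clopen(1)[OF S]]
      zC zF unfolding disjnt_iff by blast
  show "finite_part S \<subseteq> ?C"
  proof
    fix X assume X: "X \<in> finite_part S"
    have FF: "finite_part (finite_part S) = finite_part S" by (auto simp: finite_part_def)
    have "continuous_map (top_of_set {0..1}) (prod_topology (top_of_set {0..1})
        (interleaving_topology (finite_part S))) (\<lambda>t. (t, X))"
      using X by (intro continuous_map_pairedI) simp_all
    from continuous_map_compose[OF this continuous_contraction[OF F FF]]
    have "pathin (subtopology ?T (finite_part S)) (\<lambda>t. contraction (t, X))"
      unfolding pathin_def subtopology_finite_part[OF S] by (simp add: o_def)
    then have "pathin ?T (\<lambda>t. contraction (t, X))" by (simp add: pathin_subtopology)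
    then have "path_component_of ?T X zero_iso_class"
      unfolding path_component_of_def
      using contraction_0[OF F X] contraction_1[of X] by blast
    then show "X \<in> ?C" by (simp add: path_component_of_sym)
  qed
qed

lemma contractible_path_component:
  fixes S :: "'k::field rpers set set"
  assumes S: "shrink_closed S"
  shows "contractible_to (path_component_space (interleaving_topology S) zero_iso_class)
    zero_iso_class"
proof -
  have "finite_part (finite_part S) = finite_part S" by (auto simp: finite_part_def)
  then show ?thesis
    unfolding path_component_space_def path_component_zero[OF S] subtopology_finite_part[OF S]
    by (rule contractible_interleaving_topology[OF shrink_closed_finite_part[OF S]])
qed

section \<open>The classes of persistence modules\<close>

definition shrink_interval :: "real \<Rightarrow> real set \<Rightarrow> real set" where
  "shrink_interval r J = {a. a - r \<in> J \<and> a + r \<in> J}"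

lemma is_interval_shrink_interval:
  assumes "is_interval J"
  shows "is_interval (shrink_interval r J)"
  unfolding is_interval_1
proof (intro ballI allI impI)
  fix a b x assume ab: "a \<in> shrink_interval r J" "b \<in> shrink_interval r J" and "a \<le> x \<and> x \<le> b"
  then have "a - r \<le> x - r" "x - r \<le> b - r" "a + r \<le> x + r" "x + r \<le> b + r" by auto
  then show "x \<in> shrink_interval r J"
    using assms ab unfolding is_interval_1 shrink_interval_def by blast
qed

lemma shrink_interval_subset:
  assumes "is_interval J" and "0 \<le> r"
  shows "shrink_interval r J \<subseteq> J"
proof
  fix a assume "a \<in> shrink_interval r J"
  moreover have "a - r \<le> a" "a \<le> a + r" using assms(2) by auto
  ultimately show "a \<in> J"
    using assms(1) unfolding is_interval_1 shrink_interval_def by blast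
qed

text \<open>
  Summandwise: \<open>J(a - r) \<rightarrow> J(a + r)\<close> has image \<open>k\<close> if both points lie in \<open>J\<close>, and \<open>0\<close> otherwise.
  Indices whose interval shrinks to the empty set are removed, since summands of an interval sum are
  nonempty intervals. The two modules have the same spaces, and the identity is an isomorphism.
\<close>

lemma shrink_class_interval_sum:
  fixes A :: "real set" and I :: "real \<Rightarrow> real set" and r :: real
  defines "I' \<equiv> \<lambda>i. shrink_interval r (I i)"
  defines "A' \<equiv> {i\<in>A. I' i \<noteq> {}}"
  assumes I: "interval_family A I" and r: "0 \<le> r"
  shows "shrink_class r (iso_class (interval_sum A I :: 'k::field rpers))
      = iso_class (interval_sum A' I')"
    and "interval_family A' I'"
    and "i \<in> A' \<Longrightarrow> I' i \<subseteq> I i"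
proof -
  let ?M = "interval_sum A I :: 'k rpers" and ?N = "interval_sum A' I' :: 'k rpers"
  show I': "interval_family A' I'"
    using I is_interval_shrink_interval unfolding interval_family_def A'_def I'_def by auto
  show "I' i \<subseteq> I i" if "i \<in> A'" for i
    using that I shrink_interval_subset[OF _ r] unfolding interval_family_def A'_def I'_def by blast
  have M: "pers_module rscale ?M" by (rule pers_module_interval_sum[OF I])
  have N: "pers_module rscale ?N" by (rule pers_module_interval_sum[OF I'])
  have MS: "pers_module rscale (shrink r ?M)" by (rule pers_module_shrink[OF vector_space_rscale M r])
  have mem: "i \<in> A' \<and> a \<in> I' i \<longleftrightarrow> i \<in> A \<and> a - r \<in> I i \<and> a + r \<in> I i" for i a
    by (auto simp: A'_def I'_def shrink_interval_def)
  have space: "pspace (shrink r ?M) a = pspace ?N a" for a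
  proof (intro equalityI subsetI)
    fix f assume "f \<in> pspace (shrink r ?M) a"
    then obtain g where g: "g \<in> pspace ?M (a - r)" and f: "f = pmap ?M (a - r) (a + r) g"
      unfolding pspace_shrink by blast
    have supp: "f i \<noteq> 0 \<Longrightarrow> g i \<noteq> 0 \<and> i \<in> A' \<and> a \<in> I' i" for i
      unfolding mem f by (simp add: pmap_interval_sum split: if_splits)
    then have "{i. f i \<noteq> 0} \<subseteq> {i. g i \<noteq> 0}" by blast
    then show "f \<in> pspace ?N a"
      using supp g finite_subset unfolding pspace_interval_sum by blast
  next
    fix f assume f: "f \<in> pspace ?N a"
    then have "f i \<noteq> 0 \<Longrightarrow> i \<in> A \<and> a - r \<in> I i \<and> a + r \<in> I i" for i
      unfolding pspace_interval_sum mem[symmetric] by blast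
    then have "f \<in> pspace ?M (a - r)" "f = pmap ?M (a - r) (a + r) f"
      using f unfolding pspace_interval_sum by (auto simp: pmap_interval_sum fun_eq_iff)
    then show "f \<in> pspace (shrink r ?M) a" unfolding pspace_shrink by blast
  qed
  have map: "pmap (shrink r ?M) a b f = pmap ?N a b f" if "a \<le> b" "f \<in> pspace ?N a" for a b f
  proof
    fix i
    \<comment> \<open>The map from \<open>a\<close> to \<open>b\<close> in the shrunken module tests only whether \<open>a + r\<close> and \<open>b + r\<close> lie in
      the interval; the left ends \<open>a - r\<close> and \<open>b - r\<close> follow from the support of \<open>f\<close> and convexity.\<close>
    have "b - r \<in> I i" if "f i \<noteq> 0" "b + r \<in> I i"
    proof -
      have "i \<in> A" "a - r \<in> I i"
        using that \<open>f \<in> pspace ?N a\<close> mem unfolding pspace_interval_sum by blast+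
      moreover have "a - r \<le> b - r" "b - r \<le> b + r" using \<open>a \<le> b\<close> r by auto
      ultimately show ?thesis
        using I that(2) unfolding interval_family_def is_interval_1 by blast
    qed
    moreover have "i \<in> A' \<and> a \<in> I' i" if "f i \<noteq> 0"
      using that \<open>f \<in> pspace ?N a\<close> unfolding pspace_interval_sum by blast
    ultimately show "pmap (shrink r ?M) a b f i = pmap ?N a b f i"
      using mem[of i a] mem[of i b] by (auto simp: pmap_shrink pmap_interval_sum)
  qed
  have lin: "linear_map_on rscale V V (\<lambda>x. x)" for V :: "(real \<Rightarrow> 'k) set"
    by (simp add: linear_map_on_def)
  have "interleaved rscale 0 (shrink r ?M) ?N"
    unfolding interleaved_def
    by (intro exI[of _ "\<lambda>a x. x"])
      (simp add: shift_hom_def space map lin pers_moduleD(3)[OF N])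
  then show "shrink_class r (iso_class ?M) = iso_class ?N"
    unfolding shrink_class_iso_class[OF M r] by (rule iso_class_eqI[OF MS N])
qed

text \<open>
  \<open>P\<close> stands for the size restrictions (finitely or countably many summands, bounded intervals,
  intervals inside \<open>[c, d]\<close>); each of them passes to fewer and smaller intervals.
\<close>

lemma shrink_closed_interval_sums:
  fixes P :: "real set \<Rightarrow> (real \<Rightarrow> real set) \<Rightarrow> bool"
  assumes empty: "P {} (\<lambda>_. {})"
    and mono: "\<And>A I A' I'. P A I \<Longrightarrow> A' \<subseteq> A \<Longrightarrow> (\<And>i. i \<in> A' \<Longrightarrow> I' i \<subseteq> I i) \<Longrightarrow> P A' I'"
  shows "shrink_closed {iso_class (interval_sum A I :: 'k::field rpers) | A I.
    interval_family A I \<and> P A I}" (is "shrink_closed ?S")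
  unfolding shrink_closed_def
proof (intro conjI ballI allI impI)
  show "zero_iso_class \<in> ?S"
    unfolding zero_iso_class_def mem_Collect_eq
    by (rule exI[of _ "{}"], rule exI[of _ "\<lambda>_. {}"])
      (simp add: empty interval_sum_empty interval_family_def)
  fix X :: "'k rpers set" assume "X \<in> ?S"
  then obtain A I where I: "interval_family A I" "P A I" and X: "X = iso_class (interval_sum A I)"
    by blast
  show "\<exists>M. pers_module rscale M \<and> X = iso_class M"
    using pers_module_interval_sum[OF I(1)] X by blast
  fix r :: real assume r: "0 \<le> r"
  let ?I = "\<lambda>i. shrink_interval r (I i)"
  let ?A = "{i\<in>A. ?I i \<noteq> {}}"
  note sh = shrink_class_interval_sum[OF I(1) r]
  have "P ?A ?I"
    using sh(3) by (intro mono[OF I(2)]) auto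
  with sh(1,2) show "shrink_class r X \<in> ?S" unfolding X by blast
qed

lemma shrink_closed_pfd: "shrink_closed (pfd :: 'k::field rpers set set)"
  unfolding shrink_closed_def
proof (intro conjI ballI allI impI)
  interpret vector_space "rscale :: 'k \<Rightarrow> _" by (rule vector_space_rscale)
  show "zero_iso_class \<in> (pfd :: 'k rpers set set)" using zero_iso_class_mem by blast
  fix X :: "'k rpers set" assume "X \<in> pfd"
  then obtain M where X: "X = iso_class M" and M: "pers_module rscale M"
    and fd: "\<And>a. \<exists>B. finite B \<and> independent B \<and> span B = pspace M a"
    unfolding pfd_def by blast
  show "\<exists>M. pers_module rscale M \<and> X = iso_class M" using M X by blast
  fix r :: real assume r: "0 \<le> r"
  have S: "pers_module rscale (shrink r M)" by (rule pers_module_shrink[OF vector_space_rscale M r])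
  have "\<exists>B. finite B \<and> independent B \<and> span B = pspace (shrink r M) a" for a
  proof -
    obtain C where C: "finite C" "span C = pspace M (a + r)" using fd by blast
    obtain B where B: "B \<subseteq> pspace (shrink r M) a" "independent B" "pspace (shrink r M) a \<subseteq> span B"
      using maximal_independent_subset by blast
    have "B \<subseteq> span C" using B(1) pspace_shrink_subset[OF M r] C(2) by blast
    then have "finite B" using independent_span_bound[OF C(1) B(2)] by blast
    moreover have "span B = pspace (shrink r M) a"
      using B span_minimal[OF B(1) pers_moduleD(1)[OF S]] by blast
    ultimately show ?thesis using B(2) by blast
  qed
  then show "shrink_class r X \<in> pfd"
    unfolding X shrink_class_iso_class[OF M r] pfd_def using S by blast
qed

text \<open>
  If all intervals lie in \<open>[-K, K]\<close>, then every transition map of length \<open>2 (K + 1)\<close> has its start or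
  its end outside of each interval.
\<close>

lemma bounded_interval_sum_in_finite_part:
  fixes A :: "real set"
  assumes I: "interval_family A I" and A: "finite A" and b: "\<forall>i\<in>A. bounded (I i)"
    and S: "iso_class (interval_sum A I :: 'k::field rpers) \<in> S"
  shows "iso_class (interval_sum A I :: 'k rpers) \<in> finite_part S"
proof -
  let ?M = "interval_sum A I :: 'k rpers"
  have M: "pers_module rscale ?M" by (rule pers_module_interval_sum[OF I])
  have "bounded (\<Union>i\<in>A. I i)" using A b by blast
  then obtain K where K: "K > 0" "\<And>x. x \<in> (\<Union>i\<in>A. I i) \<Longrightarrow> \<bar>x\<bar> \<le> K"
    unfolding bounded_pos by auto
  have "pmap ?M a (a + 2 * (K + 1)) f = 0" for a f
  proof
    fix i
    have "\<not> (i \<in> A \<and> a \<in> I i \<and> a + 2 * (K + 1) \<in> I i)"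
      using K(2)[of a] K(2)[of "a + 2 * (K + 1)"] by fastforce
    then show "pmap ?M a (a + 2 * (K + 1)) f i = 0 i"
      by (auto simp: pmap_interval_sum)
  qed
  then have "interleaved rscale (K + 1) zero_module ?M"
    using K(1) by (subst interleaved_zero_iff[OF M]) auto
  then show ?thesis
    unfolding finite_part_iff[OF M] using S K(1) by (intro conjI exI[of _ "K + 1"]) auto
qed

theorem proposition4p17:
  fixes c d :: real
  assumes "c < d"
  shows
    "contractible_to
       (interleaving_topology (ffid_in c d :: 'k::field rpers set set)) zero_iso_class \<and>
     contractible_to
       (interleaving_topology (ffid :: 'k rpers set set)) zero_iso_class \<and>
     contractible_to
       (path_component_space (interleaving_topology (cfid :: 'k rpers set set)) zero_iso_class)
       zero_iso_class \<and>
     contractible_to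
       (path_component_space (interleaving_topology (pfd :: 'k rpers set set)) zero_iso_class)
       zero_iso_class \<and>
     contractible_to
       (path_component_space (interleaving_topology (rid :: 'k rpers set set)) zero_iso_class)
       zero_iso_class"
proof (intro conjI)
  have "shrink_closed (ffid_in c d :: 'k rpers set set)"
    unfolding ffid_in_def
    by (rule shrink_closed_interval_sums[where P = "\<lambda>A I. finite A \<and> (\<forall>i\<in>A. I i \<subseteq> {c..d})"])
      (simp, meson finite_subset subset_trans subsetD)
  moreover have "finite_part (ffid_in c d) = (ffid_in c d :: 'k rpers set set)"
  proof
    show "(ffid_in c d :: 'k rpers set set) \<subseteq> finite_part (ffid_in c d)"
    proof
      fix X :: "'k rpers set" assume X: "X \<in> ffid_in c d"
      then obtain A I where "interval_family A I" "finite A" "\<forall>i\<in>A. I i \<subseteq> {c..d}"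
        and X': "X = iso_class (interval_sum A I)"
        unfolding ffid_in_def by blast
      then show "X \<in> finite_part (ffid_in c d)"
        using X unfolding X'
        by (intro bounded_interval_sum_in_finite_part) (auto simp: bounded_subset[OF bounded_closed_interval])
    qed
  qed (auto simp: finite_part_def)
  ultimately show "contractible_to
      (interleaving_topology (ffid_in c d :: 'k rpers set set)) zero_iso_class"
    by (rule contractible_interleaving_topology)
  have "shrink_closed (ffid :: 'k rpers set set)"
    unfolding ffid_def
    by (rule shrink_closed_interval_sums[where P = "\<lambda>A I. finite A \<and> (\<forall>i\<in>A. bounded (I i))"])
      (simp, meson finite_subset bounded_subset subsetD)
  moreover have "finite_part ffid = (ffid :: 'k rpers set set)"
  proof
    show "(ffid :: 'k rpers set set) \<subseteq> finite_part ffid"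
    proof
      fix X :: "'k rpers set" assume X: "X \<in> ffid"
      then obtain A I where "interval_family A I" "finite A" "\<forall>i\<in>A. bounded (I i)"
        and X': "X = iso_class (interval_sum A I)"
        unfolding ffid_def by blast
      then show "X \<in> finite_part ffid"
        using X unfolding X' by (intro bounded_interval_sum_in_finite_part)
    qed
  qed (auto simp: finite_part_def)
  ultimately show "contractible_to
      (interleaving_topology (ffid :: 'k rpers set set)) zero_iso_class"
    by (rule contractible_interleaving_topology)
  have "shrink_closed (cfid :: 'k rpers set set)"
    unfolding cfid_def
    by (rule shrink_closed_interval_sums[where P = "\<lambda>A I. countable A \<and> (\<forall>i\<in>A. bounded (I i))"])
      (simp, meson countable_subset bounded_subset subsetD)
  then show "contractible_to (path_component_space (interleaving_topology
      (cfid :: 'k rpers set set)) zero_iso_class) zero_iso_class"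
    by (rule contractible_path_component)
  show "contractible_to (path_component_space (interleaving_topology
      (pfd :: 'k rpers set set)) zero_iso_class) zero_iso_class"
    by (rule contractible_path_component[OF shrink_closed_pfd])
  have "shrink_closed (rid :: 'k rpers set set)"
    unfolding rid_def using shrink_closed_interval_sums[of "\<lambda>_ _. True"] by simp
  then show "contractible_to (path_component_space (interleaving_topology
      (rid :: 'k rpers set set)) zero_iso_class) zero_iso_class"
    by (rule contractible_path_component)
qed

end
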